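(* Let $n,m\ge2$, let $q\in\mathbb{K}$ be a primitive $n$th root of unity, $p\in\mathbb{K}$ with $p^2=q$, and $0\le a,b<n$. If $\gcd\big((a+(m-1)b)(a-b)^{m-1},\,n\big)=1$, then $V_{a,b}$ is an inner-faithful $R$-module, where $R=\mathbb{K}\mathbb{Z}_n^{\otimes m}$.
   Context: $\mathbb{K}$ is a field of characteristic zero. $H_{n,m}$ is the Hopf algebra of dimension $n^mm!$ generated as an algebra by $x_1,\dots,x_m,z_1,\dots,z_{m-1}$ with defining relations $x_i^n=1$, $x_ix_j=x_jx_i$, $z_kx_i=x_{s_k(i)}z_k$ where $s_k=(k,k+1)$, $z_kz_l=z_lz_k$ for $|k-l|>1$, $z_kz_{k+1}z_k=z_{k+1}z_kz_{k+1}$, $z_k^2=\frac1n\sum_{i,j=0}^{n-1}q^{-ij}x_k^ix_{k+1}^j$. Its Hopf subalgebra generated by the commuting group-like elements $x_1,\dots,x_m$ is $R=\mathbb{K}\mathbb{Z}_n^{\otimes m}\cong\mathbb{K}[\mathbb{Z}_n^m]$. $V_{a,b}$ is the left $H_{n,m}$-module with $\mathbb{K}$-basis $u_1,\dots,u_m$ and action $x_i\cdot u_i=q^au_i$, $x_i\cdot u_j=q^bu_j$ for $j\ne i$, and $z_k\cdot u_k=q^{ab}u_{k+1}$, $z_k\cdot u_{k+1}=u_k$, $z_k\cdot u_j=p^{b^2}u_j$ for $j\notin\{k,k+1\}$; it is an $R$-module by restriction. A module $V$ over a Hopf algebra $K$ is inner-faithful if the only Hopf ideal of $K$ that annihilates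 $V$ is the zero ideal. *)

theory Defs
  imports Complex_Main "HOL-Algebra.Product_Groups" "HOL-Library.Poly_Mapping"
begin

section \<open>Vector spaces with a chosen basis\<close>

text \<open>
  Every vector space has a basis, so a vector space over the field \<open>'k\<close> is represented as the
  space of finitely supported functions \<open>'b \<Rightarrow>\<^sub>0 'k\<close> whose support lies in a basis \<open>B\<close>.  The tensor
  product of the spaces with bases \<open>B\<close> and \<open>C\<close> is then the space with basis \<open>B \<times> C\<close>.
\<close>

definition scale :: "'k::field \<Rightarrow> ('b \<Rightarrow>\<^sub>0 'k) \<Rightarrow> ('b \<Rightarrow>\<^sub>0 'k)" where
  "scale c f = Poly_Mapping.map (\<lambda>x. c * x) f"

lemma lookup_scale [simp]: "Poly_Mapping.lookup (scale c f) x = c * Poly_Mapping.lookup f x"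
  by (simp add: scale_def Poly_Mapping.map.rep_eq when_def)

global_interpretation pm: vector_space "scale :: 'k::field \<Rightarrow> ('b \<Rightarrow>\<^sub>0 'k) \<Rightarrow> ('b \<Rightarrow>\<^sub>0 'k)"
  by unfold_locales (auto intro!: poly_mapping_eqI simp: lookup_add algebra_simps)

definition vspace :: "'b set \<Rightarrow> ('b \<Rightarrow>\<^sub>0 'k::field) set" where
  "vspace B = {f. Poly_Mapping.keys f \<subseteq> B}"

definition bvec :: "'b \<Rightarrow> ('b \<Rightarrow>\<^sub>0 'k::field)" where
  "bvec x = Poly_Mapping.single x 1"

definition linext :: "('b \<Rightarrow> ('c \<Rightarrow>\<^sub>0 'k::field)) \<Rightarrow> ('b \<Rightarrow>\<^sub>0 'k) \<Rightarrow> ('c \<Rightarrow>\<^sub>0 'k)" where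
  "linext F f = (\<Sum>x\<in>Poly_Mapping.keys f. scale (Poly_Mapping.lookup f x) (F x))"

definition bilext ::
    "('b \<Rightarrow> 'c \<Rightarrow> ('d \<Rightarrow>\<^sub>0 'k::field)) \<Rightarrow> ('b \<Rightarrow>\<^sub>0 'k) \<Rightarrow> ('c \<Rightarrow>\<^sub>0 'k) \<Rightarrow> ('d \<Rightarrow>\<^sub>0 'k)" where
  "bilext F f g = linext (\<lambda>x. linext (F x) g) f"

definition linform :: "('b \<Rightarrow> 'k::field) \<Rightarrow> ('b \<Rightarrow>\<^sub>0 'k) \<Rightarrow> 'k" where
  "linform \<phi> f = (\<Sum>x\<in>Poly_Mapping.keys f. Poly_Mapping.lookup f x * \<phi> x)"

definition tens :: "('b \<Rightarrow>\<^sub>0 'k::field) \<Rightarrow> ('c \<Rightarrow>\<^sub>0 'k) \<Rightarrow> ('b \<times> 'c \<Rightarrow>\<^sub>0 'k)" where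
  "tens = bilext (\<lambda>x y. bvec (x, y))"

text \<open>The linear map \<open>F \<otimes> G\<close>, for linear maps given by their values on the basis.\<close>

definition tmap :: "('b \<Rightarrow> ('d \<Rightarrow>\<^sub>0 'k::field)) \<Rightarrow> ('c \<Rightarrow> ('e \<Rightarrow>\<^sub>0 'k)) \<Rightarrow>
    ('b \<times> 'c \<Rightarrow>\<^sub>0 'k) \<Rightarrow> ('d \<times> 'e \<Rightarrow>\<^sub>0 'k)" where
  "tmap F G = linext (\<lambda>(x, y). tens (F x) (G y))"


section \<open>Hopf algebras, Hopf ideals and modules\<close>

text \<open>
  The structure maps are given by their values on the basis; \<open>hmult\<close>, \<open>hcomult\<close>, \<open>hcounit\<close> and
  \<open>hantipode\<close> below are their (bi)linear extensions.
\<close>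

record (overloaded) ('b, 'k) hopf =
  basis :: "'b set"
  mult_b :: "'b \<Rightarrow> 'b \<Rightarrow> ('b \<Rightarrow>\<^sub>0 'k)"
  unit_h :: "'b \<Rightarrow>\<^sub>0 'k"
  comult_b :: "'b \<Rightarrow> ('b \<times> 'b \<Rightarrow>\<^sub>0 'k)"
  counit_b :: "'b \<Rightarrow> 'k"
  antipode_b :: "'b \<Rightarrow> ('b \<Rightarrow>\<^sub>0 'k)"

definition hcarrier :: "('b, 'k::field) hopf \<Rightarrow> ('b \<Rightarrow>\<^sub>0 'k) set" where
  "hcarrier H = vspace (basis H)"

definition hmult :: "('b, 'k::field) hopf \<Rightarrow> ('b \<Rightarrow>\<^sub>0 'k) \<Rightarrow> ('b \<Rightarrow>\<^sub>0 'k) \<Rightarrow> ('b \<Rightarrow>\<^sub>0 'k)" where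
  "hmult H = bilext (mult_b H)"

definition hcomult :: "('b, 'k::field) hopf \<Rightarrow> ('b \<Rightarrow>\<^sub>0 'k) \<Rightarrow> ('b \<times> 'b \<Rightarrow>\<^sub>0 'k)" where
  "hcomult H = linext (comult_b H)"

definition hcounit :: "('b, 'k::field) hopf \<Rightarrow> ('b \<Rightarrow>\<^sub>0 'k) \<Rightarrow> 'k" where
  "hcounit H = linform (counit_b H)"

definition hantipode :: "('b, 'k::field) hopf \<Rightarrow> ('b \<Rightarrow>\<^sub>0 'k) \<Rightarrow> ('b \<Rightarrow>\<^sub>0 'k)" where
  "hantipode H = linext (antipode_b H)"

text \<open>The multiplication of the tensor square: \<open>(x \<otimes> y) (x' \<otimes> y') = x x' \<otimes> y y'\<close>.\<close>

definition hmult2 :: "('b, 'k::field) hopf \<Rightarrow>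
    ('b \<times> 'b \<Rightarrow>\<^sub>0 'k) \<Rightarrow> ('b \<times> 'b \<Rightarrow>\<^sub>0 'k) \<Rightarrow> ('b \<times> 'b \<Rightarrow>\<^sub>0 'k)" where
  "hmult2 H = bilext (\<lambda>(x, y) (x', y'). tens (mult_b H x x') (mult_b H y y'))"

definition hopf_algebra :: "('b, 'k::field) hopf \<Rightarrow> bool" where
  "hopf_algebra H \<longleftrightarrow>
     unit_h H \<in> hcarrier H \<and>
     (\<forall>x\<in>basis H. \<forall>y\<in>basis H. mult_b H x y \<in> hcarrier H) \<and>
     (\<forall>x\<in>basis H. comult_b H x \<in> vspace (basis H \<times> basis H)) \<and>
     (\<forall>x\<in>basis H. antipode_b H x \<in> hcarrier H) \<and>
     (\<forall>x\<in>basis H. \<forall>y\<in>basis H. \<forall>z\<in>basis H.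
        hmult H (mult_b H x y) (bvec z) = hmult H (bvec x) (mult_b H y z)) \<and>
     (\<forall>x\<in>basis H. hmult H (unit_h H) (bvec x) = bvec x \<and> hmult H (bvec x) (unit_h H) = bvec x) \<and>
     (\<forall>x\<in>basis H.
        linext (\<lambda>((u, v), w). bvec (u, (v, w))) (tmap (comult_b H) bvec (comult_b H x))
          = tmap bvec (comult_b H) (comult_b H x)) \<and>
     (\<forall>x\<in>basis H.
        linext (\<lambda>(u, v). scale (counit_b H u) (bvec v)) (comult_b H x) = bvec x \<and>
        linext (\<lambda>(u, v). scale (counit_b H v) (bvec u)) (comult_b H x) = bvec x) \<and>
     hcomult H (unit_h H) = tens (unit_h H) (unit_h H) \<and>
     (\<forall>x\<in>basis H. \<forall>y\<in>basis H.
        hcomult H (mult_b H x y) = hmult2 H (comult_b H x) (comult_b H y)) \<and>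
     hcounit H (unit_h H) = 1 \<and>
     (\<forall>x\<in>basis H. \<forall>y\<in>basis H.
        hcounit H (mult_b H x y) = counit_b H x * counit_b H y) \<and>
     (\<forall>x\<in>basis H.
        linext (\<lambda>(u, v). hmult H (antipode_b H u) (bvec v)) (comult_b H x)
          = scale (counit_b H x) (unit_h H) \<and>
        linext (\<lambda>(u, v). hmult H (bvec u) (antipode_b H v)) (comult_b H x)
          = scale (counit_b H x) (unit_h H))"

definition hopf_ideal :: "('b, 'k::field) hopf \<Rightarrow> ('b \<Rightarrow>\<^sub>0 'k) set \<Rightarrow> bool" where
  "hopf_ideal H I \<longleftrightarrow>
     I \<subseteq> hcarrier H \<and> pm.subspace I \<and>
     (\<forall>x\<in>I. \<forall>h\<in>hcarrier H. hmult H h x \<in> I \<and> hmult H x h \<in> I) \<and>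
     (\<forall>x\<in>I. hcomult H x \<in> pm.span ({tens y h | y h. y \<in> I \<and> h \<in> hcarrier H} \<union>
                                      {tens h y | h y. h \<in> hcarrier H \<and> y \<in> I})) \<and>
     (\<forall>x\<in>I. hcounit H x = 0) \<and>
     (\<forall>x\<in>I. hantipode H x \<in> I)"

record (overloaded) ('b, 'v, 'k) hmodule =
  vbasis :: "'v set"
  act_b :: "'b \<Rightarrow> 'v \<Rightarrow> ('v \<Rightarrow>\<^sub>0 'k)"

definition hact :: "('b, 'v, 'k::field) hmodule \<Rightarrow> ('b \<Rightarrow>\<^sub>0 'k) \<Rightarrow> ('v \<Rightarrow>\<^sub>0 'k) \<Rightarrow> ('v \<Rightarrow>\<^sub>0 'k)" where
  "hact V = bilext (act_b V)"

definition left_module :: "('b, 'k::field) hopf \<Rightarrow> ('b, 'v, 'k) hmodule \<Rightarrow> bool" where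
  "left_module H V \<longleftrightarrow>
     (\<forall>h\<in>hcarrier H. \<forall>v\<in>vspace (vbasis V). hact V h v \<in> vspace (vbasis V)) \<and>
     (\<forall>v\<in>vspace (vbasis V). hact V (unit_h H) v = v) \<and>
     (\<forall>g\<in>hcarrier H. \<forall>h\<in>hcarrier H. \<forall>v\<in>vspace (vbasis V).
        hact V (hmult H g h) v = hact V g (hact V h v))"

definition annihilates ::
    "('b \<Rightarrow>\<^sub>0 'k::field) set \<Rightarrow> ('b, 'v, 'k) hmodule \<Rightarrow> bool" where
  "annihilates I V \<longleftrightarrow> (\<forall>h\<in>I. \<forall>v\<in>vspace (vbasis V). hact V h v = 0)"

definition inner_faithful :: "('b, 'k::field) hopf \<Rightarrow> ('b, 'v, 'k) hmodule \<Rightarrow> bool" where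
  "inner_faithful H V \<longleftrightarrow> (\<forall>I. hopf_ideal H I \<and> annihilates I V \<longrightarrow> I = {0})"


section \<open>Group algebras\<close>

definition group_algebra :: "('g, 'r) monoid_scheme \<Rightarrow> ('g, 'k::field) hopf" where
  "group_algebra G = \<lparr>basis = carrier G,
     mult_b = (\<lambda>g h. bvec (g \<otimes>\<^bsub>G\<^esub> h)),
     unit_h = bvec \<one>\<^bsub>G\<^esub>,
     comult_b = (\<lambda>g. bvec (g, g)),
     counit_b = (\<lambda>g. 1),
     antipode_b = (\<lambda>g. bvec (inv\<^bsub>G\<^esub> g))\<rparr>"

lemma linext_bvec [simp]: "linext F (bvec x) = F x"
  by (simp add: linext_def bvec_def)

lemma bilext_bvec [simp]: "bilext F (bvec x) (bvec y) = F x y"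
  by (simp add: bilext_def)

lemma tens_bvec [simp]: "tens (bvec x) (bvec y) = bvec (x, y)"
  by (simp add: tens_def)

lemma linform_bvec [simp]: "linform \<phi> (bvec x) = \<phi> x"
  by (simp add: linform_def bvec_def)

lemma bvec_in_vspace [simp]: "bvec x \<in> (vspace B :: ('b \<Rightarrow>\<^sub>0 'k::field) set) \<longleftrightarrow> x \<in> B"
  by (simp add: vspace_def bvec_def)

lemma hopf_algebra_group_algebra:
  assumes "group G"
  shows "hopf_algebra (group_algebra G :: ('g, 'k::field) hopf)"
proof -
  interpret group G by fact
  show ?thesis
    by (simp add: hopf_algebra_def group_algebra_def hcarrier_def hmult_def hcomult_def
        hcounit_def hmult2_def tmap_def m_assoc)
qed


section \<open>The Hopf algebra \<open>R\<close> and the module \<open>V\<^bsub>a,b\<^esub>\<close>\<close>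

text \<open>
  \<open>R\<close> is the \<open>m\<close>-fold tensor power of the group algebra of the cyclic group of order \<open>n\<close>, that is,
  the group algebra of its \<open>m\<close>-th direct power.  The product of the powers \<open>x\<^sub>i\<close> to the \<open>g i\<close>, with
  \<open>i\<close> from \<open>1\<close> to \<open>m\<close>, is the basis vector at the group element \<open>g\<close>.
\<close>

definition R_alg :: "nat \<Rightarrow> nat \<Rightarrow> (nat \<Rightarrow> int, 'k::field) hopf" where
  "R_alg n m = group_algebra (product_group {1..m} (\<lambda>_. integer_mod_group n))"

lemma hopf_algebra_R_alg: "hopf_algebra (R_alg n m :: (nat \<Rightarrow> int, 'k::field) hopf)"
  unfolding R_alg_def by (rule hopf_algebra_group_algebra) simp

datatype gen = Gen_x nat | Gen_z nat

text \<open>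
  The action of the generators \<open>x\<^sub>i\<close> (\<open>1 \<le> i \<le> m\<close>) and \<open>z\<^sub>k\<close> (\<open>1 \<le> k < m\<close>) of \<open>H\<^bsub>n,m\<^esub>\<close> on the
  basis \<open>u\<^sub>1, \<dots>, u\<^sub>m\<close> of \<open>V\<^bsub>a,b\<^esub>\<close>; \<open>u\<^sub>j\<close> is \<open>bvec j\<close>.
\<close>

fun V_gen :: "'k::field \<Rightarrow> 'k \<Rightarrow> nat \<Rightarrow> nat \<Rightarrow> gen \<Rightarrow> nat \<Rightarrow> (nat \<Rightarrow>\<^sub>0 'k)" where
  "V_gen q p a b (Gen_x i) j = (if j = i then scale (q ^ a) (bvec j) else scale (q ^ b) (bvec j))"
| "V_gen q p a b (Gen_z k) j =
     (if j = k then scale (q ^ (a * b)) (bvec (k + 1))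
      else if j = k + 1 then bvec k
      else scale (p ^ (b ^ 2)) (bvec j))"

definition V_op :: "'k::field \<Rightarrow> 'k \<Rightarrow> nat \<Rightarrow> nat \<Rightarrow> gen \<Rightarrow> (nat \<Rightarrow>\<^sub>0 'k) \<Rightarrow> (nat \<Rightarrow>\<^sub>0 'k)" where
  "V_op q p a b s = linext (V_gen q p a b s)"

text \<open>The restriction of \<open>V\<^bsub>a,b\<^esub>\<close> to \<open>R\<close>: a group element acts by the corresponding monomial in
  the operators of the \<open>x\<^sub>i\<close>.\<close>

definition V_res :: "nat \<Rightarrow> 'k::field \<Rightarrow> 'k \<Rightarrow> nat \<Rightarrow> nat \<Rightarrow> (nat \<Rightarrow> int, nat, 'k) hmodule" where
  "V_res m q p a b = \<lparr>vbasis = {1..m},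
     act_b = (\<lambda>g j. foldr (\<lambda>i. V_op q p a b (Gen_x i) ^^ nat (g i)) [1..<m + 1] (bvec j))\<rparr>"

definition primitive_root_of_unity :: "nat \<Rightarrow> 'k::field \<Rightarrow> bool" where
  "primitive_root_of_unity n q \<longleftrightarrow> n > 0 \<and> q ^ n = 1 \<and> (\<forall>k. 0 < k \<and> k < n \<longrightarrow> q ^ k \<noteq> 1)"

end

theory Submission
  imports Defs
begin

text \<open>
  The linear forms on \<open>\<bbbK>[G]\<close> vanishing on a Hopf ideal \<open>I\<close> contain the counit and are closed
  under convolution, since the comultiplication maps \<open>I\<close> into \<open>I \<otimes> \<bbbK>[G] + \<bbbK>[G] \<otimes> I\<close>.  As
  functions on \<open>G\<close> they therefore form a unital algebra under the pointwise operations.  If it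
  separates the points of \<open>G\<close>, Lagrange interpolation shows that it contains a function isolating
  any given point of the support of an element of \<open>I\<close>, so that \<open>I = 0\<close>.  For \<open>V\<^bsub>a,b\<^esub>\<close>, the algebra
  contains the characters \<open>\<chi>\<^sub>j\<close> by which \<open>G = \<int>\<^sub>n\<^sup>m\<close> acts on \<open>u\<^sub>j\<close>; they separate points because the
  circulant matrix with \<open>a\<close> on the diagonal and \<open>b\<close> elsewhere has determinant
  \<open>(a + (m - 1) b) (a - b)\<^sup>m\<^sup>-\<^sup>1\<close>, a unit modulo \<open>n\<close>.
\<close>

section \<open>Linear forms\<close>

lemma linform_superset:
  assumes "finite A" "Poly_Mapping.keys f \<subseteq> A"
  shows "linform \<phi> f = (\<Sum>x\<in>A. Poly_Mapping.lookup f x * \<phi> x)"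
  unfolding linform_def using assms
  by (intro sum.mono_neutral_left) (auto simp: in_keys_iff)

lemma linform_zero [simp]: "linform \<phi> 0 = 0"
  by (simp add: linform_def)

lemma linform_add: "linform \<phi> (f + g) = linform \<phi> f + linform \<phi> g"
proof -
  let ?A = "Poly_Mapping.keys f \<union> Poly_Mapping.keys g"
  have "Poly_Mapping.keys (f + g) \<subseteq> ?A"
    by (rule Poly_Mapping.keys_add)
  then show ?thesis
    by (simp add: linform_superset[of ?A] lookup_add distrib_right sum.distrib)
qed

lemma linform_scale [simp]: "linform \<phi> (scale c f) = c * linform \<phi> f"
proof -
  have "Poly_Mapping.keys (scale c f) \<subseteq> Poly_Mapping.keys f"
    by (auto simp: in_keys_iff)
  then show ?thesis
    by (simp add: linform_superset[of "Poly_Mapping.keys f"] sum_distrib_left mult.assoc)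
qed

lemma linform_sum: "linform \<phi> (\<Sum>x\<in>A. F x) = (\<Sum>x\<in>A. linform \<phi> (F x))"
  by (induction A rule: infinite_finite_induct) (simp_all add: linform_add)

lemma linform_linext: "linform \<phi> (linext F f) = linform (\<lambda>x. linform \<phi> (F x)) f"
  by (simp add: linext_def linform_sum) (simp add: linform_def)

lemma linform_cong:
  "(\<And>x. x \<in> Poly_Mapping.keys f \<Longrightarrow> \<phi> x = \<psi> x) \<Longrightarrow> linform \<phi> f = linform \<psi> f"
  by (simp add: linform_def)

lemma linform_mult_const: "linform (\<lambda>x. c * \<phi> x) f = c * linform \<phi> f"
  by (simp add: linform_def sum_distrib_left mult.left_commute)

lemma linform_mult_const_right: "linform (\<lambda>x. \<phi> x * c) f = linform \<phi> f * c"
  by (simp add: linform_def sum_distrib_right mult.assoc)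

lemma linform_diff_const:
  "linform (\<lambda>x. \<phi> x - c) f = linform \<phi> f - c * linform (\<lambda>_. 1) f"
  by (simp add: linform_def algebra_simps sum_subtractf sum_distrib_left)

lemma linform_indicator: "linform (\<lambda>x. if x = y then c else 0) f = Poly_Mapping.lookup f y * c"
  by (simp add: linform_def if_distrib sum.delta in_keys_iff cong: if_cong)

lemma lookup_eq_linform:
  "Poly_Mapping.lookup f y = linform (\<lambda>x. if x = y then 1 else 0) f"
  by (simp add: linform_indicator)

lemma linform_tens:
  "linform (\<lambda>(x, y). \<phi> x * \<psi> y) (tens f g) = linform \<phi> f * linform \<psi> g"
  by (simp add: tens_def bilext_def linform_linext linform_mult_const linform_mult_const_right)


section \<open>Hopf ideals of group algebras\<close>

text \<open>A function multiplicative on \<open>G\<close> extends to an algebra homomorphism.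
  Multiplicativity is needed only on the carrier, where the supports lie.\<close>

lemma linform_group_algebra_mult:
  fixes \<chi> :: "'g \<Rightarrow> 'k::field"
  assumes \<chi>: "\<And>x y. x \<in> carrier G \<Longrightarrow> y \<in> carrier G \<Longrightarrow> \<chi> (x \<otimes>\<^bsub>G\<^esub> y) = \<chi> x * \<chi> y"
    and "f \<in> hcarrier (group_algebra G)" "g \<in> hcarrier (group_algebra G)"
  shows "linform \<chi> (hmult (group_algebra G) f g) = linform \<chi> f * linform \<chi> g"
proof -
  have sub: "Poly_Mapping.keys f \<subseteq> carrier G" "Poly_Mapping.keys g \<subseteq> carrier G"
    using assms(2,3) by (auto simp: hcarrier_def vspace_def group_algebra_def)
  have "linform \<chi> (hmult (group_algebra G) f g)
      = linform (\<lambda>x. linform (\<lambda>y. \<chi> (x \<otimes>\<^bsub>G\<^esub> y)) g) f"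
    by (simp add: hmult_def group_algebra_def bilext_def linform_linext)
  also have "\<dots> = linform (\<lambda>x. linform (\<lambda>y. \<chi> x * \<chi> y) g) f"
    using sub by (intro linform_cong) (auto intro!: \<chi>)
  also have "\<dots> = linform \<chi> f * linform \<chi> g"
    by (simp add: linform_mult_const linform_mult_const_right)
  finally show ?thesis .
qed

text \<open>Group elements are group-like, so the pointwise product is the convolution of
  \<open>\<phi>\<close> and \<open>\<psi>\<close>: the comultiplication followed by
  \<open>\<phi>\<close> on the first factor and \<open>\<psi>\<close> on the second. That form on
  the tensor square kills every generator of the span, because one factor of each lies in
  \<open>I\<close>.\<close>

lemma hopf_ideal_vanishing_mult:
  assumes I: "hopf_ideal (group_algebra G) I"
    and \<phi>: "\<And>f. f \<in> I \<Longrightarrow> linform \<phi> f = 0" and \<psi>: "\<And>f. f \<in> I \<Longrightarrow> linform \<psi> f = 0"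
    and "f \<in> I"
  shows "linform (\<lambda>x. \<phi> x * \<psi> x) f = 0"
proof -
  let ?H = "group_algebra G" and ?\<Phi> = "\<lambda>(x, y). \<phi> x * \<psi> y"
  let ?S = "{tens y h | y h. y \<in> I \<and> h \<in> hcarrier ?H} \<union> {tens h y | h y. h \<in> hcarrier ?H \<and> y \<in> I}"
  have "pm.span ?S \<subseteq> {t. linform ?\<Phi> t = 0}"
  proof (rule pm.span_minimal)
    show "?S \<subseteq> {t. linform ?\<Phi> t = 0}"
      by (auto simp: linform_tens \<phi> \<psi>)
    show "pm.subspace {t. linform ?\<Phi> t = 0}"
      by (rule pm.subspaceI) (auto simp: linform_add)
  qed
  moreover have "hcomult ?H f \<in> pm.span ?S"
    using I \<open>f \<in> I\<close> unfolding hopf_ideal_def by blast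
  ultimately have "linform ?\<Phi> (hcomult ?H f) = 0"
    by blast
  then show ?thesis
    by (simp add: hcomult_def group_algebra_def linform_linext)
qed

text \<open>The constant function 1 is the counit of a group algebra.\<close>

lemma hopf_ideal_vanishing_one:
  assumes "hopf_ideal (group_algebra G) I" "f \<in> I"
  shows "linform (\<lambda>_. 1) f = 0"
  using assms by (simp add: hopf_ideal_def hcounit_def group_algebra_def)

lemma hopf_ideal_eq_zeroI:
  assumes I: "hopf_ideal (group_algebra G) I"
    and sep: "\<And>g h. g \<in> carrier G \<Longrightarrow> h \<in> carrier G \<Longrightarrow> g \<noteq> h \<Longrightarrow>
      \<exists>\<phi>. (\<forall>f\<in>I. linform \<phi> f = 0) \<and> \<phi> g \<noteq> \<phi> h"
  shows "I = {0}"
proof -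
  have "Poly_Mapping.lookup f h = 0" if f: "f \<in> I" for f h
  proof (rule ccontr)
    assume "Poly_Mapping.lookup f h \<noteq> 0"
    then have h: "h \<in> Poly_Mapping.keys f"
      by (simp add: in_keys_iff)
    have sub: "Poly_Mapping.keys f \<subseteq> carrier G"
      using I f by (auto simp: hopf_ideal_def hcarrier_def vspace_def group_algebra_def)
    define K where "K = Poly_Mapping.keys f - {h}"
    have "\<forall>g\<in>K. \<exists>\<phi>. (\<forall>f\<in>I. linform \<phi> f = 0) \<and> \<phi> g \<noteq> \<phi> h"
      using sep sub h unfolding K_def by blast
    then obtain \<Phi> where \<Phi>: "\<And>g f. g \<in> K \<Longrightarrow> f \<in> I \<Longrightarrow> linform (\<Phi> g) f = 0"
      and ne: "\<And>g. g \<in> K \<Longrightarrow> \<Phi> g g \<noteq> \<Phi> g h"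
      by metis
    \<comment> \<open>Numerator of a Lagrange polynomial: zero at the points of \<open>A\<close>,
      nonzero at \<open>h\<close> when \<open>A\<close> is contained in \<open>K\<close>.\<close>
    define L where "L = (\<lambda>A x. \<Prod>g\<in>A. \<Phi> g x - \<Phi> g g)"
    have "finite K"
      by (simp add: K_def)
    \<comment> \<open>Each factor combines a form vanishing on \<open>I\<close> with the counit. The
      element \<open>f'\<close> stays arbitrary because the product lemma needs vanishing on all of
      \<open>I\<close>.\<close>
    have van: "linform (L A) f' = 0" if "A \<subseteq> K" "f' \<in> I" for A f'
      using finite_subset[OF \<open>A \<subseteq> K\<close> \<open>finite K\<close>] that
    proof (induction A arbitrary: f' rule: finite_induct)
      case empty
      then show ?case
        using hopf_ideal_vanishing_one[OF I] by (simp add: L_def)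
    next
      case (insert g A)
      have "linform (\<lambda>x. (\<Phi> g x - \<Phi> g g) * L A x) f' = 0"
      proof (rule hopf_ideal_vanishing_mult[OF I _ _ insert.prems(2)])
        show "linform (\<lambda>x. \<Phi> g x - \<Phi> g g) f'' = 0" if "f'' \<in> I" for f''
          using \<Phi> insert.prems(1) hopf_ideal_vanishing_one[OF I that] that
          by (simp add: linform_diff_const)
        show "linform (L A) f'' = 0" if "f'' \<in> I" for f''
          using insert.IH insert.prems(1) that by simp
      qed
      moreover have "L (insert g A) = (\<lambda>x. (\<Phi> g x - \<Phi> g g) * L A x)"
        using insert.hyps by (simp add: L_def fun_eq_iff)
      ultimately show ?case
        by simp
    qed
    have "L K x = 0" if "x \<in> K" for x
      using that \<open>finite K\<close> by (auto simp: L_def)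
    \<comment> \<open>On the support of \<open>f\<close>, the function \<open>L K\<close> is a
      multiple of the indicator of \<open>h\<close>.\<close>
    then have "linform (L K) f = linform (\<lambda>x. if x = h then L K h else 0) f"
      by (intro linform_cong) (auto simp: K_def)
    then have "Poly_Mapping.lookup f h * L K h = 0"
      using van[OF order_refl f] by (simp add: linform_indicator)
    moreover have "L K h \<noteq> 0"
      using \<open>finite K\<close> by (auto simp: L_def dest: ne)
    ultimately show False
      using \<open>Poly_Mapping.lookup f h \<noteq> 0\<close> by simp
  qed
  then have "I \<subseteq> {0}"
    by (auto intro: poly_mapping_eqI)
  moreover have "0 \<in> I"
    using I pm.subspace_0 unfolding hopf_ideal_def by blast
  ultimately show ?thesis
    by blast
qed


section \<open>Arithmetic\<close>

lemma primitive_root_power_eq_iff: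
  assumes q: "primitive_root_of_unity n q"
  shows "q ^ x = q ^ y \<longleftrightarrow> x mod n = y mod n"
proof -
  have n: "n > 0" and qn: "q ^ n = 1" and prim: "\<And>k. 0 < k \<Longrightarrow> k < n \<Longrightarrow> q ^ k \<noteq> 1"
    using q by (auto simp: primitive_root_of_unity_def)
  have q0: "q \<noteq> 0"
    using n qn by (metis power_0_left less_irrefl zero_neq_one)
  have red: "q ^ x = q ^ (x mod n)" for x
    using qn by (metis mod_mult_div_eq power_add power_mult power_one mult.right_neutral)
  \<comment> \<open>Cancelling \<open>q ^ x\<close> leaves \<open>q ^ (y - x) = 1\<close> with an
    exponent below \<open>n\<close>, which must then be 0.\<close>
  have inj: "x = y" if "q ^ x = q ^ y" "x \<le> y" "y < n" for x y
  proof -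
    have "q ^ y = q ^ x * q ^ (y - x)"
      using that by (metis le_add_diff_inverse power_add)
    then have "q ^ (y - x) = 1"
      using that q0 by simp
    then show ?thesis
      using prim[of "y - x"] that by fastforce
  qed
  have "x mod n = y mod n" if "q ^ x = q ^ y"
    using inj[of "x mod n" "y mod n"] inj[of "y mod n" "x mod n"] that red[of x] red[of y] n
    by (metis linorder_le_cases mod_less_divisor)
  then show ?thesis
    using red[of x] red[of y] by metis
qed

text \<open>Instead of a determinant: adding all rows gives \<open>(a + (m - 1) b) D\<close>
  congruent to 0, where \<open>D\<close> is the sum of the \<open>d i\<close>. Hence
  \<open>n\<close> divides \<open>D\<close>, and row \<open>j\<close> reduces to
  \<open>(a - b) * d j\<close>.\<close>

lemma circulant_mod_injective:
  fixes n a b :: int and d :: "nat \<Rightarrow> int"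
  assumes cop: "coprime ((a + (int m - 1) * b) * (a - b) ^ (m - 1)) n" and "m \<ge> 2"
    and dvd: "\<And>j. j \<in> {1..m} \<Longrightarrow> n dvd (\<Sum>i=1..m. (if j = i then a else b) * d i)"
    and "j \<in> {1..m}"
  shows "n dvd d j"
proof -
  define D where "D = (\<Sum>i=1..m. d i)"
  have row: "(\<Sum>i=1..m. (if j = i then a else b) * d i) = (a - b) * d j + b * D"
    if "j \<in> {1..m}" for j
  proof -
    have "(\<Sum>i=1..m. (if j = i then a else b) * d i)
        = (\<Sum>i=1..m. (if j = i then (a - b) * d i else 0) + b * d i)"
      by (intro sum.cong) (auto simp: algebra_simps)
    also have "\<dots> = (a - b) * d j + b * D"
      using that by (simp add: sum.distrib sum_distrib_left D_def)
    finally show ?thesis .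
  qed
  have "n dvd (\<Sum>j=1..m. (a - b) * d j + b * D)"
    using dvd row by (intro dvd_sum) metis
  also have "(\<Sum>j=1..m. (a - b) * d j + b * D) = (a - b) * D + int m * (b * D)"
    by (simp add: sum.distrib D_def flip: sum_distrib_left)
  also have "\<dots> = (a + (int m - 1) * b) * D"
    by (simp add: algebra_simps)
  finally have "n dvd (a + (int m - 1) * b) * D" .
  \<comment> \<open>As \<open>m \<ge> 2\<close>, the exponent \<open>m - 1\<close> is positive, so
    coprimality passes from the power to \<open>a - b\<close>.\<close>
  moreover have c: "coprime (a + (int m - 1) * b) n" "coprime (a - b) n"
    using cop \<open>m \<ge> 2\<close> by auto
  ultimately have "n dvd D"
    by (simp add: coprime_commute coprime_dvd_mult_right_iff)
  then have "n dvd (a - b) * d j"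
    using dvd[OF \<open>j \<in> {1..m}\<close>] row[OF \<open>j \<in> {1..m}\<close>]
    by (metis dvd_add_left_iff dvd_mult)
  then show ?thesis
    using c(2) by (simp add: coprime_commute coprime_dvd_mult_right_iff)
qed


section \<open>The characters of the module\<close>

text \<open>The eigenvalue of \<open>g\<close> on the basis vector \<open>bvec j\<close>. For
  \<open>n > 0\<close> the entries of \<open>g\<close> are representatives from 0 to
  \<open>n - 1\<close>, so \<open>nat\<close> loses nothing.\<close>

definition V_char :: "nat \<Rightarrow> 'k::field \<Rightarrow> nat \<Rightarrow> nat \<Rightarrow> nat \<Rightarrow> (nat \<Rightarrow> int) \<Rightarrow> 'k" where
  "V_char m q a b j g = (\<Prod>i=1..m. (q ^ (if j = i then a else b)) ^ nat (g i))"

lemma V_op_funpow_scale_bvec: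
  "(V_op q p a b (Gen_x i) ^^ k) (scale c (bvec j))
     = scale (c * (q ^ (if j = i then a else b)) ^ k) (bvec j)"
proof (induction k)
  case (Suc k)
  have "V_op q p a b (Gen_x i) (scale d (bvec j)) = scale (d * q ^ (if j = i then a else b)) (bvec j)"
    for d
    by (rule poly_mapping_eqI) (simp add: V_op_def lookup_eq_linform linform_linext)
  with Suc show ?case
    by (simp add: mult.assoc mult.commute)
qed simp

lemma V_res_act: "act_b (V_res m q p a b) g j = scale (V_char m q a b j g) (bvec j)"
proof -
  have "foldr (\<lambda>i. V_op q p a b (Gen_x i) ^^ nat (g i)) is (bvec j)
      = scale (\<Prod>i\<leftarrow>is. (q ^ (if j = i then a else b)) ^ nat (g i)) (bvec j)" for "is"
    by (induction "is") (simp_all add: V_op_funpow_scale_bvec mult.commute del: V_gen.simps)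
  moreover have "(\<Prod>i\<leftarrow>[1..<m + 1]. (q ^ (if j = i then a else b)) ^ nat (g i)) = V_char m q a b j g"
    unfolding V_char_def
    by (subst prod.distinct_set_conv_list[symmetric]) (auto intro!: prod.cong)
  ultimately show ?thesis
    by (simp add: V_res_def)
qed

text \<open>The action is diagonal in the basis, so each coordinate is multiplied by the linear
  extension of its character.\<close>

lemma lookup_V_res_hact:
  "Poly_Mapping.lookup (hact (V_res m q p a b) h v) j
     = linform (V_char m q a b j) h * Poly_Mapping.lookup v j"
proof -
  have "(\<lambda>g. linform (\<lambda>i. V_char m q a b i g * (if i = j then 1 else 0)) v)
      = (\<lambda>g. V_char m q a b j g * Poly_Mapping.lookup v j)"
  proof
    fix g
    have "linform (\<lambda>i. V_char m q a b i g * (if i = j then 1 else 0)) v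
        = linform (\<lambda>i. if i = j then V_char m q a b j g else 0) v"
      by (rule linform_cong) simp
    then show "linform (\<lambda>i. V_char m q a b i g * (if i = j then 1 else 0)) v
        = V_char m q a b j g * Poly_Mapping.lookup v j"
      by (simp add: linform_indicator mult.commute)
  qed
  then show ?thesis
    by (simp add: hact_def bilext_def V_res_act lookup_eq_linform[of "linext _ _"] linform_linext
        linform_mult_const_right)
qed

text \<open>The group law reduces exponents modulo \<open>n\<close>, which is harmless since
  \<open>q ^ n = 1\<close>.\<close>

lemma V_char_mult:
  assumes "q ^ n = 1" "n > 0"
    and "g \<in> carrier (product_group {1..m} (\<lambda>_. integer_mod_group n))"
    and "h \<in> carrier (product_group {1..m} (\<lambda>_. integer_mod_group n))"
  shows "V_char m q a b j (g \<otimes>\<^bsub>product_group {1..m} (\<lambda>_. integer_mod_group n)\<^esub> h)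
    = V_char m q a b j g * V_char m q a b j h"
proof -
  have "(q ^ e) ^ nat ((x + y) mod int n) = (q ^ e) ^ nat x * (q ^ e) ^ nat y"
    if "x \<ge> 0" "y \<ge> 0" for x y :: int and e
  proof -
    have "(q ^ e) ^ n = 1"
      using \<open>q ^ n = 1\<close> by (metis mult.commute power_mult power_one)
    then have "(q ^ e) ^ (k mod n) = (q ^ e) ^ k" for k
      by (metis mod_mult_div_eq power_add power_mult power_one mult.right_neutral)
    then show ?thesis
      using that by (simp add: nat_mod_distrib nat_add_distrib flip: power_add)
  qed
  \<comment> \<open>This uses \<open>n > 0\<close>: \<open>integer_mod_group 0\<close> is the group
    of all integers.\<close>
  moreover have "g i \<ge> 0" "h i \<ge> 0" if "i \<in> {1..m}" for i
    using assms that by (auto simp: carrier_integer_mod_group PiE_iff split: if_splits)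
  ultimately show ?thesis
    by (simp add: V_char_def mult_integer_mod_group flip: prod.distrib)
qed

lemma V_char_one: "V_char m q a b j \<one>\<^bsub>product_group {1..m} (\<lambda>_. integer_mod_group n)\<^esub> = 1"
  by (simp add: V_char_def)

text \<open>Comparing exponents of \<open>q\<close> modulo \<open>n\<close> turns the equalities of
  characters into a homogeneous circulant system for \<open>g - h\<close>.\<close>

lemma V_char_separates:
  assumes q: "primitive_root_of_unity n q" and "m \<ge> 2"
    and cop: "coprime ((int a + (int m - 1) * int b) * (int a - int b) ^ (m - 1)) (int n)"
    and g: "g \<in> carrier (product_group {1..m} (\<lambda>_. integer_mod_group n))"
    and h: "h \<in> carrier (product_group {1..m} (\<lambda>_. integer_mod_group n))"
    and eq: "\<And>j. j \<in> {1..m} \<Longrightarrow> V_char m q a b j g = V_char m q a b j h"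
  shows "g = h"
proof -
  have "n > 0"
    using q by (simp add: primitive_root_of_unity_def)
  then have bnd: "0 \<le> g i" "g i < int n" "0 \<le> h i" "h i < int n" if "i \<in> {1..m}" for i
    using g h that by (auto simp: carrier_integer_mod_group PiE_iff)
  define e where "e = (\<lambda>j i :: nat. if j = i then a else b)"
  have V_char: "V_char m q a b j x = q ^ (\<Sum>i=1..m. e j i * nat (x i))" for j x
    by (simp add: V_char_def e_def power_sum power_mult)
  have "int n dvd (\<Sum>i=1..m. (if j = i then int a else int b) * (g i - h i))" if j: "j \<in> {1..m}" for j
  proof -
    have "(\<Sum>i=1..m. e j i * nat (g i)) mod n = (\<Sum>i=1..m. e j i * nat (h i)) mod n"
      using eq[OF j] by (simp only: V_char primitive_root_power_eq_iff[OF q])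
    then have "int n dvd int (\<Sum>i=1..m. e j i * nat (g i)) - int (\<Sum>i=1..m. e j i * nat (h i))"
      by (metis mod_eq_dvd_iff of_nat_mod)
    also have "\<dots> = (\<Sum>i=1..m. (if j = i then int a else int b) * (g i - h i))"
      unfolding of_nat_sum sum_subtractf[symmetric] using bnd
      by (intro sum.cong) (auto simp: e_def algebra_simps)
    finally show ?thesis .
  qed
  then have dvd: "int n dvd g j - h j" if "j \<in> {1..m}" for j
    using circulant_mod_injective[OF cop \<open>m \<ge> 2\<close>, of "\<lambda>i. g i - h i"] that by blast
  \<comment> \<open>Congruent representatives in the range from 0 to \<open>n - 1\<close> coincide;
    off \<open>{1..m}\<close> both functions are \<open>undefined\<close>.\<close>
  have "g j = h j" if "j \<in> {1..m}" for j
    using dvd[OF that] bnd[OF that] by (metis mod_eq_dvd_iff mod_pos_pos_trivial)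
  then show ?thesis
    using g h by (auto intro: PiE_ext)
qed

theorem lemma17:
  fixes n m a b :: nat
    and q p :: "'k::field_char_0"
  assumes "n \<ge> 2" and "m \<ge> 2"
    and "primitive_root_of_unity n q"
    and "p ^ 2 = q"
    and "a < n" and "b < n"
    and "gcd ((int a + (int m - 1) * int b) * (int a - int b) ^ (m - 1)) (int n) = 1"
  shows "left_module (R_alg n m) (V_res m q p a b) \<and>
         inner_faithful (R_alg n m) (V_res m q p a b)"
proof
  let ?G = "product_group {1..m} (\<lambda>_. integer_mod_group n)" and ?V = "V_res m q p a b"
  have vb: "vbasis ?V = {1..m}"
    by (simp add: V_res_def)
  have qn: "q ^ n = 1" "n > 0"
    using assms(3) by (auto simp: primitive_root_of_unity_def)
  have cop: "coprime ((int a + (int m - 1) * int b) * (int a - int b) ^ (m - 1)) (int n)"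
    using assms(7) by (simp only: coprime_iff_gcd_eq_1)
  show "left_module (R_alg n m) ?V"
    unfolding left_module_def R_alg_def
  proof (intro conjI ballI)
    show "hact ?V h v \<in> vspace (vbasis ?V)" if "v \<in> vspace (vbasis ?V)" for h v
      using that by (auto simp: vspace_def subset_iff in_keys_iff lookup_V_res_hact)
    show "hact ?V (unit_h (group_algebra ?G)) v = v" for v
      by (rule poly_mapping_eqI)
        (simp add: lookup_V_res_hact group_algebra_def V_char_one del: One_nat_def one_product_group)
    show "hact ?V (hmult (group_algebra ?G) g h) v = hact ?V g (hact ?V h v)"
      if "g \<in> hcarrier (group_algebra ?G)" "h \<in> hcarrier (group_algebra ?G)" for g h v
    proof (rule poly_mapping_eqI)
      fix j
      have "linform (V_char m q a b j) (hmult (group_algebra ?G) g h)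
          = linform (V_char m q a b j) g * linform (V_char m q a b j) h"
        by (rule linform_group_algebra_mult[OF _ that]) (rule V_char_mult[OF qn])
      then show "Poly_Mapping.lookup (hact ?V (hmult (group_algebra ?G) g h) v) j
          = Poly_Mapping.lookup (hact ?V g (hact ?V h v)) j"
        by (simp only: lookup_V_res_hact mult.assoc)
    qed
  qed
  show "inner_faithful (R_alg n m) ?V"
    unfolding inner_faithful_def R_alg_def
  proof (intro allI impI, elim conjE)
    fix I :: "((nat \<Rightarrow> int) \<Rightarrow>\<^sub>0 'k) set"
    assume I: "hopf_ideal (group_algebra ?G) I" and ann: "annihilates I ?V"
    have van: "linform (V_char m q a b j) f = 0" if "j \<in> {1..m}" "f \<in> I" for j f
    proof -
      \<comment> \<open>Coordinate \<open>j\<close> of this vector is the value at \<open>f\<close>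
        of the extended character.\<close>
      have "hact ?V f (bvec j) = 0"
        using ann that vb by (simp add: annihilates_def)
      then show ?thesis
        using lookup_V_res_hact[of m q p a b f "bvec j" j] by (simp add: bvec_def)
    qed
    show "I = {0}"
    proof (rule hopf_ideal_eq_zeroI[OF I])
      show "\<exists>\<phi>. (\<forall>f\<in>I. linform \<phi> f = 0) \<and> \<phi> g \<noteq> \<phi> h"
        if "g \<in> carrier ?G" "h \<in> carrier ?G" "g \<noteq> h" for g h
        \<comment> \<open>By contraposition, distinct \<open>g\<close> and \<open>h\<close> differ
          under some character with index in \<open>{1..m}\<close>; it serves as
          \<open>\<phi>\<close>.\<close>
        using V_char_separates[OF assms(3,2) cop that(1,2)] that(3) van by blast
    qed
  qed
qed

end
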